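(* Let $X$ be a separable Banach space, let $\delta\in(0,1]$, and let $\mathcal S_\delta=\{\mathcal S_\delta(t)\}_{t\ge 0}\subset\mathcal L(X)$ be a $C_0$--$\delta$--semigroup on $X$. Let $\mathcal T(s):=\mathcal S_\delta((\delta s)^{1/\delta})$, $s\ge0$, which is a classical $C_0$-semigroup on $X$. Then $$X_0^\delta=X_0,\qquad X_\infty^\delta=X_\infty,\qquad X_p^\delta=X_p,$$ where these sets are as defined in the context. In particular, $\mathcal S_\delta$ is $\delta$-hypercyclic (resp. $\delta$-chaotic) if and only if $\mathcal T$ is hypercyclic (resp. chaotic) in the classical sense.
   Context: $\mathcal L(X)$ denotes the bounded linear operators on $X$. A family $\{\mathcal S_\delta(t)\}_{t\ge0}\subset\mathcal L(X)$ is a conformable $\delta$--semigroup if $\mathcal S_\delta(0)=\mathrm{Id}$ and $\mathcal S_\delta((r+q)^{1/\delta})=\mathcal S_\delta(r^{1/\delta})\,\mathcal S_\delta(q^{1/\delta})$ for all $r,q\ge 0$. It is a $C_0$--$\delta$--semigroup if in addition $\lim_{t\to0^+}\mathcal S_\delta(t)x=x$ for all $x\in X$. For $\mathcal S_\delta$ define $X_0^\delta=\{x\in X:\lim_{t\to\infty}\mathcal S_\delta(t)x=0\}$; $X_\infty^\delta=\{x\in X:\forall\varepsilon>0\ \exists y\in X,\ t>0\text{ with }\|y\|<\varepsilon\text{ and }\|\mathcal S_\delta(t)y-x\|<\varepsilon\}$; $X_p^\delta=\{x\in X:\exists t>0\text{ with }\mathcal S_\delta(t)x=x\}$. The sets $X_0$,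 $X_\infty$, $X_p$ are defined identically with $\mathcal T(s)$, $s>0$, in place of $\mathcal S_\delta(t)$, $t>0$: $X_0=\{x:\lim_{s\to\infty}\mathcal T(s)x=0\}$; $X_\infty=\{x:\forall\varepsilon>0\ \exists y\in X,\ s>0:\ \|y\|<\varepsilon,\ \|\mathcal T(s)y-x\|<\varepsilon\}$; $X_p=\{x:\exists s>0\text{ with }\mathcal T(s)x=x\}$. $\mathcal S_\delta$ is $\delta$-hypercyclic if there exists $x\in X$ with $\{\mathcal S_\delta(t)x:t\ge0\}$ dense in $X$, and $\delta$-chaotic if it is $\delta$-hypercyclic and $X_p^\delta$ is dense in $X$. Classically, $\mathcal T$ is hypercyclic if some orbit $\{\mathcal T(s)x:s\ge0\}$ is dense in $X$, and chaotic if it is hypercyclic and $X_p$ is dense in $X$. *)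

theory Defs
  imports "HOL-Analysis.Analysis"
begin

(* A family {S(t)}, t >= 0, is represented by a total function on the reals; every
   definition below inspects its values at nonnegative arguments only. *)

definition delta_semigroup :: "real \<Rightarrow> (real \<Rightarrow> 'a::real_normed_vector \<Rightarrow>\<^sub>L 'a) \<Rightarrow> bool" where
  "delta_semigroup \<delta> S \<longleftrightarrow>
     S 0 = id_blinfun \<and>
     (\<forall>r\<ge>0. \<forall>q\<ge>0. S ((r + q) powr (1 / \<delta>)) = S (r powr (1 / \<delta>)) o\<^sub>L S (q powr (1 / \<delta>)))"

definition C0_delta_semigroup :: "real \<Rightarrow> (real \<Rightarrow> 'a::real_normed_vector \<Rightarrow>\<^sub>L 'a) \<Rightarrow> bool" where
  "C0_delta_semigroup \<delta> S \<longleftrightarrow>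
     delta_semigroup \<delta> S \<and> (\<forall>x. ((\<lambda>t. blinfun_apply (S t) x) \<longlongrightarrow> x) (at_right 0))"

definition C0_semigroup :: "(real \<Rightarrow> 'a::real_normed_vector \<Rightarrow>\<^sub>L 'a) \<Rightarrow> bool" where
  "C0_semigroup T \<longleftrightarrow>
     T 0 = id_blinfun \<and>
     (\<forall>r\<ge>0. \<forall>q\<ge>0. T (r + q) = T r o\<^sub>L T q) \<and>
     (\<forall>x. ((\<lambda>t. blinfun_apply (T t) x) \<longlongrightarrow> x) (at_right 0))"

(* The remaining notions depend only on the family of operators and not on delta or on
   a semigroup law, so one definition serves both conformable and classical semigroups:
   X_zero, X_infty, X_per of S are the sets X_0, X_infinity, X_p of S. *)

definition X_zero :: "(real \<Rightarrow> 'a::real_normed_vector \<Rightarrow>\<^sub>L 'a) \<Rightarrow> 'a set" where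
  "X_zero S = {x. ((\<lambda>t. blinfun_apply (S t) x) \<longlongrightarrow> 0) at_top}"

definition X_infty :: "(real \<Rightarrow> 'a::real_normed_vector \<Rightarrow>\<^sub>L 'a) \<Rightarrow> 'a set" where
  "X_infty S = {x. \<forall>\<epsilon>>0. \<exists>y. \<exists>t>0. norm y < \<epsilon> \<and> norm (blinfun_apply (S t) y - x) < \<epsilon>}"

definition X_per :: "(real \<Rightarrow> 'a::real_normed_vector \<Rightarrow>\<^sub>L 'a) \<Rightarrow> 'a set" where
  "X_per S = {x. \<exists>t>0. blinfun_apply (S t) x = x}"

definition hypercyclic :: "(real \<Rightarrow> 'a::real_normed_vector \<Rightarrow>\<^sub>L 'a) \<Rightarrow> bool" where
  "hypercyclic S \<longleftrightarrow> (\<exists>x. closure ((\<lambda>t. blinfun_apply (S t) x) ` {0..}) = UNIV)"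

definition chaotic :: "(real \<Rightarrow> 'a::real_normed_vector \<Rightarrow>\<^sub>L 'a) \<Rightarrow> bool" where
  "chaotic S \<longleftrightarrow> hypercyclic S \<and> closure (X_per S) = UNIV"

end

theory Submission
  imports Defs "HOL-Real_Asymp.Real_Asymp"
begin

text \<open>
  The map \<open>s \<mapsto> (\<delta> s)\<^sup>1\<^sup>/\<^sup>\<delta>\<close> is an increasing homeomorphism of the half-line, with inverse
  \<open>t \<mapsto> t\<^sup>\<delta> / \<delta>\<close>. It fixes the origin, preserves positivity and tends to infinity with \<open>s\<close>, while each
  of the notions concerned only sees a family up to such a reparametrisation.
\<close>

text \<open>Limits at infinity compose, and agreement of \<open>T\<close> with \<open>S\<close>
  along \<open>f\<close> at all large times is enough for a limit. Only one inclusion results; the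
  inverse time change supplies the other.\<close>

lemma X_zero_reparam:
  assumes "filterlim f at_top at_top" and "\<And>s. s \<ge> 0 \<Longrightarrow> T s = S (f s)"
  shows "X_zero S \<subseteq> X_zero T"
proof
  fix x assume "x \<in> X_zero S"
  then have "((\<lambda>s. blinfun_apply (S (f s)) x) \<longlongrightarrow> 0) at_top"
    unfolding X_zero_def using filterlim_compose[OF _ assms(1)] by auto
  moreover have "\<forall>\<^sub>F s in at_top. blinfun_apply (S (f s)) x = blinfun_apply (T s) x"
    using eventually_ge_at_top[of 0] by eventually_elim (simp add: assms(2))
  ultimately show "x \<in> X_zero T"
    unfolding X_zero_def by (auto elim: Lim_transform_eventually)
qed

text \<open>A witness \<open>y\<close> at time \<open>s\<close> for \<open>T\<close> serves
  \<open>S\<close> at time \<open>f s\<close>, so this inclusion runs opposite to the one for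
  limits.\<close>

lemma X_infty_reparam:
  assumes "\<And>s. s > 0 \<Longrightarrow> f s > 0" and "\<And>s. s \<ge> 0 \<Longrightarrow> T s = S (f s)"
  shows "X_infty T \<subseteq> X_infty S"
  unfolding X_infty_def using assms by (smt (verit, ccfv_threshold) Collect_mono)

lemma X_per_reparam:
  assumes "\<And>s. s > 0 \<Longrightarrow> f s > 0" and "\<And>s. s \<ge> 0 \<Longrightarrow> T s = S (f s)"
  shows "X_per T \<subseteq> X_per S"
  unfolding X_per_def using assms by (smt (verit, ccfv_threshold) Collect_mono)

text \<open>As \<open>f\<close> maps the half-line onto itself, every vector has the same orbit, as
  a set, under both families.\<close>

lemma hypercyclic_reparam:
  assumes "f ` {0..} = {0..}" and "\<And>s. s \<ge> 0 \<Longrightarrow> T s = S (f s)"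
  shows "hypercyclic S \<longleftrightarrow> hypercyclic T"
proof -
  have "(\<lambda>t. blinfun_apply (S t) x) ` {0..} = (\<lambda>s. blinfun_apply (T s) x) ` {0..}" for x
    by (subst assms(1)[symmetric]) (auto simp: image_image assms(2) intro!: image_cong)
  then show ?thesis
    unfolding hypercyclic_def by simp
qed

text \<open>The conformable law is additive in \<open>t powr \<delta>\<close>, which at the changed
  time is \<open>\<delta> * s\<close>, linear in \<open>s\<close>.\<close>

lemma C0_semigroup_reparam:
  fixes S T :: "real \<Rightarrow> 'a::real_normed_vector \<Rightarrow>\<^sub>L 'a"
  assumes "0 < \<delta>" and "C0_delta_semigroup \<delta> S"
    and T: "\<And>s. s \<ge> 0 \<Longrightarrow> T s = S ((\<delta> * s) powr (1 / \<delta>))"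
  shows "C0_semigroup T"
  unfolding C0_semigroup_def
proof (intro conjI allI impI)
  have S: "S 0 = id_blinfun"
    "\<And>r q. r \<ge> 0 \<Longrightarrow> q \<ge> 0 \<Longrightarrow> S ((r + q) powr (1 / \<delta>)) = S (r powr (1 / \<delta>)) o\<^sub>L S (q powr (1 / \<delta>))"
    "\<And>x. ((\<lambda>t. blinfun_apply (S t) x) \<longlongrightarrow> x) (at_right 0)"
    using assms(2) by (auto simp: C0_delta_semigroup_def delta_semigroup_def)
  show "T 0 = id_blinfun"
    by (simp add: T S(1))
  show "T (r + q) = T r o\<^sub>L T q" if "r \<ge> 0" "q \<ge> 0" for r q
    using that S(2)[of "\<delta> * r" "\<delta> * q"] \<open>0 < \<delta>\<close> by (simp add: T distrib_left)
  show "((\<lambda>t. blinfun_apply (T t) x) \<longlongrightarrow> x) (at_right 0)" for x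
  proof (rule Lim_transform_eventually)
    \<comment> \<open>The time change approaches 0 through positive values, as the one-sided limit
      of \<open>S\<close> requires.\<close>
    have "filterlim (\<lambda>s. (\<delta> * s) powr (1 / \<delta>)) (at_right 0) (at_right 0)"
      using \<open>0 < \<delta>\<close> by real_asymp
    then show "((\<lambda>s. blinfun_apply (S ((\<delta> * s) powr (1 / \<delta>))) x) \<longlongrightarrow> x) (at_right 0)"
      by (rule filterlim_compose[OF S(3)])
    show "\<forall>\<^sub>F s in at_right 0. blinfun_apply (S ((\<delta> * s) powr (1 / \<delta>))) x = blinfun_apply (T s) x"
      using eventually_at_right_less[of 0] by eventually_elim (simp add: T)
  qed
qed

theorem lemma4:
  fixes S T :: "real \<Rightarrow> 'a::banach \<Rightarrow>\<^sub>L 'a"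
    and \<delta> :: real
  assumes "separable_space (euclidean :: 'a topology)"
    and "0 < \<delta>" and "\<delta> \<le> 1"
    and "C0_delta_semigroup \<delta> S"
    and "\<And>s. s \<ge> 0 \<Longrightarrow> T s = S ((\<delta> * s) powr (1 / \<delta>))"
  shows "C0_semigroup T
    \<and> X_zero S = X_zero T \<and> X_infty S = X_infty T \<and> X_per S = X_per T
    \<and> (hypercyclic S \<longleftrightarrow> hypercyclic T)
    \<and> (chaotic S \<longleftrightarrow> chaotic T)"
proof -
  define f where "f s = (\<delta> * s) powr (1 / \<delta>)" for s
  define g where "g t = t powr \<delta> / \<delta>" for t
  have T: "T s = S (f s)" if "s \<ge> 0" for s
    using assms(5) that by (simp add: f_def)
  \<comment> \<open>At \<open>t = 0\<close> this rests on \<open>0 powr a = 0\<close>.\<close>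
  have fg: "f (g t) = t" if "t \<ge> 0" for t
    using \<open>0 < \<delta>\<close> that by (simp add: f_def g_def powr_powr)
  \<comment> \<open>With this relation the one-sided lemmas apply again, \<open>S\<close> and
    \<open>T\<close> exchanged and \<open>g\<close> in place of \<open>f\<close>.\<close>
  have S: "S t = T (g t)" if "t \<ge> 0" for t
    using that T[of "g t"] fg \<open>0 < \<delta>\<close> by (simp add: g_def)
  have f_pos: "f s > 0" and g_pos: "g s > 0" if "s > 0" for s
    using \<open>0 < \<delta>\<close> that by (simp_all add: f_def g_def)
  have f_lim: "filterlim f at_top at_top" and g_lim: "filterlim g at_top at_top"
    unfolding f_def g_def using \<open>0 < \<delta>\<close> by real_asymp+
  have f_image: "f ` {0..} = {0..}"
  proof
    show "f ` {0..} \<subseteq> {0..}"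
      by (auto simp: f_def)
    show "{0..} \<subseteq> f ` {0..}"
    proof
      fix t :: real assume "t \<in> {0..}"
      then show "t \<in> f ` {0..}"
        using fg[of t] \<open>0 < \<delta>\<close> by (intro image_eqI[of _ _ "g t"]) (auto simp: g_def)
    qed
  qed
  have per: "X_per S = X_per T"
    using X_per_reparam[of f T S, OF f_pos T] X_per_reparam[of g S T, OF g_pos S] by blast
  have hyp: "hypercyclic S \<longleftrightarrow> hypercyclic T"
    using f_image T by (rule hypercyclic_reparam)
  show ?thesis
    using C0_semigroup_reparam[OF assms(2,4,5)] per hyp
      X_zero_reparam[of f T S, OF f_lim T] X_zero_reparam[of g S T, OF g_lim S]
      X_infty_reparam[of f T S, OF f_pos T] X_infty_reparam[of g S T, OF g_pos S]
    by (auto simp: chaotic_def)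
qed

end
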